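(* Let $\gamma_0\in(0,1)$ and $C_T>0$ be the constants described in the context. Let $f:\mathbb{Z}_N\to\mathbb{C}$ be nonzero. Suppose that there exists a generic set $M\subset\mathbb{Z}_N$ such that $$\|f\|_{L^2(M^c)}\le r\,\|f\|_2$$ for some $r\in(0,1)$, with $|M|\le\gamma_0\frac{N}{\log N}$. Suppose that $$r<\frac{1-r}{C_T\sqrt{\log(N)\log\log(N)}}.$$ Then, with probability $1-o_N(1)$, $$\mathrm{FR}(f)\ \ge\ \sqrt N\cdot\frac{1-r\,\frac{C_T\sqrt{\log(N)\log\log(N)}}{1-r}}{\frac{C_T\sqrt{\log(N)\log\log(N)}}{1-r}} .$$
   Context: $\mathbb{Z}_N=\mathbb{Z}/N\mathbb{Z}$. For $f:\mathbb{Z}_N\to\mathbb{C}$ the unitary Fourier transform is $\widehat f(m)=N^{-1/2}\sum_{x\in\mathbb{Z}_N}e^{-2\pi i xm/N}f(x)$. For $A\subset\mathbb{Z}_N$, $\|g\|_{L^p(A)}=\left(\sum_{x\in A}|g(x)|^p\right)^{1/p}$ (counting measure), $\|g\|_p=\|g\|_{L^p(\mathbb{Z}_N)}$, and $A^c=\mathbb{Z}_N\setminus A$. The Fourier ratio of a nonzero $f$ is $\mathrm{FR}(f)=\|\widehat f\|_1/\|\widehat f\|_2$. Generic set: for $0<p<1$, a random set $S\subset[n]=\{0,1,\dots,n-1\}$ is called generic if each element of $[n]$ is selected independently with probability $p$. Probability in the claim is over the random choice of the generic set $M$. The constants $\gamma_0$ and $C_T$ are those provided by the following known result (a consequence of a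 theorem of Talagrand): there exists $\gamma_0\in(0,1)$, and a constant $C_T>0$ depending only on $\gamma_0$, such that if $h:\mathbb{Z}_N\to\mathbb{C}$ is supported in a generic set $M$ of size $\gamma_0\frac{N}{\log N}$, then with probability $1-o_N(1)$, $$\left(\frac1N\sum_{m\in\mathbb{Z}_N}|\widehat h(m)|^2\right)^{1/2}\le C_T\,(\log(N)\log\log(N))^{1/2}\cdot\frac1N\sum_{m\in\mathbb{Z}_N}|\widehat h(m)| .$$ *)

theory Defs
  imports "HOL-Probability.Probability"
begin

text \<open>
  The group of integers modulo \<open>N\<close> is represented by \<open>{..<N}\<close>; a function on it is a function
  \<open>nat \<Rightarrow> complex\<close> of which only the values on \<open>{..<N}\<close> are ever used.
\<close>

definition dft :: "nat \<Rightarrow> (nat \<Rightarrow> complex) \<Rightarrow> nat \<Rightarrow> complex" where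
  "dft N f m =
     complex_of_real (1 / sqrt (real N)) *
     (\<Sum>x<N. exp (- 2 * complex_of_real pi * \<i> * of_nat x * of_nat m / of_nat N) * f x)"

definition Lp_norm :: "real \<Rightarrow> nat set \<Rightarrow> (nat \<Rightarrow> complex) \<Rightarrow> real" where
  "Lp_norm p A g = (\<Sum>x\<in>A. cmod (g x) powr p) powr (1 / p)"

definition Fourier_ratio :: "nat \<Rightarrow> (nat \<Rightarrow> complex) \<Rightarrow> real" where
  "Fourier_ratio N f = Lp_norm 1 {..<N} (dft N f) / Lp_norm 2 {..<N} (dft N f)"

text \<open>
  The law of a generic subset of \<open>{0, \<dots>, N - 1}\<close>: each element is selected independently with
  probability \<open>p\<close>. It is meant for \<open>0 < p < 1\<close> (\<^const>\<open>bernoulli_pmf\<close> truncates its argument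
  to the unit interval).
\<close>

definition generic_set :: "nat \<Rightarrow> real \<Rightarrow> nat set pmf" where
  "generic_set N p =
     map_pmf (\<lambda>b. {x \<in> {..<N}. b x}) (Pi_pmf {..<N} False (\<lambda>_. bernoulli_pmf p))"

text \<open>
  The property of the constants \<open>\<gamma>0\<close> and \<open>C\<^sub>T\<close> provided by Talagrand's theorem. A generic set of
  size \<open>\<gamma>0 N / log N\<close> has selection probability \<open>\<gamma>0 / log N\<close>, i.e. that expected size. The
  function \<open>h\<close> may depend on the random set \<open>M\<close>, so it is quantified inside the event. Small \<open>N\<close>,
  for which \<open>log log N\<close> is not positive or the selection probability exceeds 1, do not affect
  the limit.
\<close>

definition Talagrand_constants :: "real \<Rightarrow> real \<Rightarrow> bool" where
  "Talagrand_constants \<gamma>0 C \<longleftrightarrow>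
     ((\<lambda>N. measure_pmf.prob (generic_set N (\<gamma>0 / ln (real N)))
        {M. \<forall>h :: nat \<Rightarrow> complex. (\<forall>x<N. x \<notin> M \<longrightarrow> h x = 0) \<longrightarrow>
              sqrt (1 / real N * (\<Sum>m<N. (cmod (dft N h m))\<^sup>2))
                \<le> C * sqrt (ln (real N) * ln (ln (real N))) *
                   (1 / real N * (\<Sum>m<N. cmod (dft N h m)))})
      \<longlonglongrightarrow> 1)"

end

theory Submission
  imports Defs
begin

text \<open>
  Talagrand's inequality holds for all functions supported in \<open>M\<close> only if it does so for every
  subset of \<open>M\<close>, so the sets violating it form an increasing family. The conditional probability
  of an increasing family given the cardinality \<open>j\<close> is nondecreasing in \<open>j\<close>; hence for \<open>k\<close> below
  the mean \<open>\<gamma>0 N / log N\<close> the probability that a generic set, of whatever density, is violating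
  and of size at most \<open>k\<close> is at most the conditional probability given size \<open>k\<close>. As the binomial
  law of parameter \<open>\<gamma>0 / log N\<close> gives mass at least \<open>1/2\<close> to \<open>{k..N}\<close>, this is at most twice the
  violation probability at that density, which tends to \<open>0\<close>.

  On a set \<open>M\<close> satisfying Talagrand's inequality, the bound on \<open>FR(f)\<close> follows by splitting \<open>f\<close>
  into its restrictions to \<open>M\<close> and to the complement, using Talagrand's inequality for the first,
  Cauchy-Schwarz for the second, and Plancherel.
\<close>

section \<open>Increasing families of subsets\<close>

lemma pmf_generic_set:
  assumes p: "0 \<le> p" "p \<le> 1" and M: "M \<subseteq> {..<N}"
  shows "pmf (generic_set N p) M = p ^ card M * (1 - p) ^ (N - card M)"
proof -
  have fin: "finite M"
    using M finite_subset by blast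
  have "pmf (generic_set N p) M =
      measure_pmf.prob (Pi_pmf {..<N} False (\<lambda>_. bernoulli_pmf p)) {b. {x \<in> {..<N}. b x} = M}"
    unfolding generic_set_def pmf_map by (simp add: vimage_def)
  \<comment> \<open>Many \<open>b\<close> yield the same \<open>M\<close>, since values outside
    \<open>{..<N}\<close> are ignored. \<open>Pi_pmf\<close> fixes the default \<open>False\<close>
    there, so only the indicator of \<open>M\<close> has mass.\<close>
  also have "\<dots> = measure_pmf.prob (Pi_pmf {..<N} False (\<lambda>_. bernoulli_pmf p)) {\<lambda>x. x \<in> M}"
  proof (rule measure_prob_cong_0)
    fix b assume b: "b \<in> {b. {x \<in> {..<N}. b x} = M} - {\<lambda>x. x \<in> M}"
    have "\<exists>x. x \<notin> {..<N} \<and> b x \<noteq> False"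
    proof (rule ccontr)
      assume "\<not> ?thesis"
      then have "b = (\<lambda>x. x \<in> M)"
        using b by fastforce
      with b show False
        by simp
    qed
    then show "pmf (Pi_pmf {..<N} False (\<lambda>_. bernoulli_pmf p)) b = 0"
      by (intro pmf_Pi_outside) auto
  next
    fix b assume "b \<in> {\<lambda>x. x \<in> M} - {b. {x \<in> {..<N}. b x} = M}"
    then show "pmf (Pi_pmf {..<N} False (\<lambda>_. bernoulli_pmf p)) b = 0"
      using M by auto
  qed
  also have "\<dots> = (\<Prod>x<N. if x \<in> M then p else 1 - p)"
    unfolding measure_pmf_single
    using M p by (subst pmf_Pi') (auto intro!: prod.cong)
  also have "\<dots> = (\<Prod>x\<in>M. p) * (\<Prod>x\<in>{..<N} - M. 1 - p)"
    using M by (subst prod.If_cases) (auto simp: Int_absorb1 Diff_eq)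
  finally show ?thesis
    using M fin by (simp add: card_Diff_subset)
qed

lemma set_pmf_generic_set: "set_pmf (generic_set N p) \<subseteq> Pow {..<N}"
  by (auto simp: generic_set_def)

definition slice :: "nat \<Rightarrow> nat set set \<Rightarrow> nat \<Rightarrow> nat set set" where
  "slice N B j = {M. M \<subseteq> {..<N} \<and> card M = j \<and> M \<in> B}"

lemma finite_slice [simp]: "finite (slice N B j)"
  by (rule finite_subset[of _ "Pow {..<N}"]) (auto simp: slice_def)

text \<open>Sets of equal cardinality are equally likely and sets outside \<open>Pow {..<N}\<close>
  are null, so the probability depends only on the layer counts.\<close>

lemma prob_generic_set:
  assumes p: "0 \<le> p" "p \<le> 1"
  shows "measure_pmf.prob (generic_set N p) B =
    (\<Sum>j\<le>N. real (card (slice N B j)) * (p ^ j * (1 - p) ^ (N - j)))"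
proof -
  have "measure_pmf.prob (generic_set N p) B =
      measure_pmf.prob (generic_set N p) (B \<inter> Pow {..<N})"
    using set_pmf_generic_set[of N p] by (intro measure_prob_cong_0) (auto simp: set_pmf_iff)
  also have "B \<inter> Pow {..<N} = (\<Union>j\<le>N. slice N B j)"
    using card_mono[of "{..<N}"] by (auto simp: slice_def)
  also have "measure_pmf.prob (generic_set N p) \<dots> =
      (\<Sum>j\<le>N. sum (pmf (generic_set N p)) (slice N B j))"
    by (subst measure_measure_pmf_finite, simp, subst sum.UNION_disjoint)
       (simp, simp, simp add: slice_def disjoint_iff, simp)
  also have "\<dots> = (\<Sum>j\<le>N. real (card (slice N B j)) * (p ^ j * (1 - p) ^ (N - j)))"
  proof (rule sum.cong)
    fix j assume "j \<in> {..N}"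
    have "sum (pmf (generic_set N p)) (slice N B j) =
        (\<Sum>M\<in>slice N B j. p ^ j * (1 - p) ^ (N - j))"
      by (rule sum.cong) (auto simp: slice_def pmf_generic_set[OF p])
    then show "sum (pmf (generic_set N p)) (slice N B j) =
        real (card (slice N B j)) * (p ^ j * (1 - p) ^ (N - j))"
      by simp
  qed simp
  finally show ?thesis .
qed

section \<open>Increasing families in consecutive layers\<close>

text \<open>Double counting of pairs: adding a new point \<open>x\<close> to \<open>M\<close> stays
  in \<open>B\<close> by upward closure, and a set of size \<open>Suc j\<close> arises in this way
  at most once for each of its points.\<close>

lemma card_slice_Suc:
  assumes up: "\<forall>A\<in>B. \<forall>A'. A \<subseteq> A' \<longrightarrow> A' \<in> B"
  shows "card (slice N B j) * (N - j) \<le> card (slice N B (Suc j)) * Suc j"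
proof -
  have fin: "finite M" if "M \<in> slice N B i" for M i
    using that finite_subset by (auto simp: slice_def)
  let ?P = "SIGMA M:slice N B j. {..<N} - M"
  let ?Q = "SIGMA M:slice N B (Suc j). M"
  have P: "card ?P = card (slice N B j) * (N - j)"
  proof -
    have "card ({..<N} - M) = N - j" if "M \<in> slice N B j" for M
      using that fin[OF that] by (simp add: slice_def card_Diff_subset)
    then show ?thesis
      by (subst card_SigmaI) auto
  qed
  have Q: "card ?Q = card (slice N B (Suc j)) * Suc j"
  proof -
    have "card M = Suc j" if "M \<in> slice N B (Suc j)" for M
      using that by (simp add: slice_def)
    then show ?thesis
      using fin by (subst card_SigmaI) auto
  qed
  have "card ?P \<le> card ?Q"
  proof (rule card_inj_on_le)
    \<comment> \<open>Keeping \<open>x\<close> as second component makes the map injective: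
      \<open>M\<close> is recovered by removing \<open>x\<close>, which was not in it.\<close>
    show "inj_on (\<lambda>(M, x). (insert x M, x)) ?P"
      by (rule inj_onI) (clarsimp, metis insert_ident)
    show "(\<lambda>(M, x). (insert x M, x)) ` ?P \<subseteq> ?Q"
    proof -
      have "insert x M \<in> slice N B (Suc j)" if M: "M \<in> slice N B j" and x: "x < N" "x \<notin> M" for M x
        using M x fin[OF M] up[rule_format, of M "insert x M"] by (auto simp: slice_def)
      then show ?thesis
        by auto
    qed
    show "finite ?Q"
      using fin by (intro finite_SigmaI) auto
  qed
  then show ?thesis
    unfolding P Q .
qed

text \<open>The quotient is the probability of \<open>B\<close> under the uniform law on sets of
  size \<open>j\<close>. Each step divides \<open>card_slice_Suc\<close> by the identity relating
  consecutive binomial coefficients.\<close>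

lemma slice_density_mono:
  assumes up: "\<forall>A\<in>B. \<forall>A'. A \<subseteq> A' \<longrightarrow> A' \<in> B"
    and "i \<le> j" "j \<le> N"
  shows "real (card (slice N B i)) / real (N choose i) \<le> real (card (slice N B j)) / real (N choose j)"
  using \<open>i \<le> j\<close> \<open>j \<le> N\<close>
proof (induction j rule: dec_induct)
  case base
  show ?case by simp
next
  case (step n)
  have n: "n < N"
    using step by simp
  have "(N - n) * (N choose n) = Suc n * (N choose Suc n)"
    using binomial_absorption[of n N] binomial_absorb_comp[of N n] by simp
  then have choose: "real (N - n) * real (N choose n) = real (Suc n) * real (N choose Suc n)"
    by (metis of_nat_mult)
  have pos: "real (N choose n) > 0" "real (N choose Suc n) > 0" "real (N - n) > 0"
    using n by auto
  have "real (card (slice N B n)) * real (N - n) \<le> real (card (slice N B (Suc n))) * real (Suc n)"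
    unfolding of_nat_mult[symmetric] of_nat_le_iff by (rule card_slice_Suc[OF up])
  then have "real (card (slice N B n)) * real (N - n) * real (N choose Suc n)
      \<le> real (card (slice N B (Suc n))) * real (Suc n) * real (N choose Suc n)"
    by (rule mult_right_mono) simp
  also have "\<dots> = real (card (slice N B (Suc n))) * (real (N - n) * real (N choose n))"
    unfolding choose by (simp only: mult_ac)
  finally have "real (N - n) * (real (card (slice N B n)) * real (N choose Suc n))
      \<le> real (N - n) * (real (card (slice N B (Suc n))) * real (N choose n))"
    by (simp only: mult_ac)
  then have "real (card (slice N B n)) * real (N choose Suc n)
      \<le> real (card (slice N B (Suc n))) * real (N choose n)"
    using pos(3) by (rule mult_left_le_imp_le)
  then have "real (card (slice N B n)) / real (N choose n)
      \<le> real (card (slice N B (Suc n))) / real (N choose Suc n)"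
    using pos by (simp add: divide_le_eq pos_le_divide_eq mult.commute)
  with step show ?case
    by linarith
qed

section \<open>The upper half of the binomial distribution\<close>

text \<open>The ratio of consecutive binomial weights, cross-multiplied to avoid division.\<close>

lemma binomial_weight_Suc:
  fixes q :: real
  assumes "j < N"
  shows "real (N choose Suc j) * q ^ Suc j * (1 - q) ^ (N - Suc j) * (real (Suc j) * (1 - q)) =
    (real N - real j) * q * (real (N choose j) * q ^ j * (1 - q) ^ (N - j))"
proof -
  have "(N - j) * (N choose j) = Suc j * (N choose Suc j)"
    using binomial_absorption[of j N] binomial_absorb_comp[of N j] by simp
  then have choose: "real (N - j) * real (N choose j) = real (Suc j) * real (N choose Suc j)"
    by (metis of_nat_mult)
  have pow: "(1 - q) ^ (N - j) = (1 - q) ^ (N - Suc j) * (1 - q)"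
    using assms by (metis Suc_diff_Suc power_Suc2)
  have "real (N choose Suc j) * q ^ Suc j * (1 - q) ^ (N - Suc j) * (real (Suc j) * (1 - q)) =
      real (Suc j) * real (N choose Suc j) * q ^ Suc j * ((1 - q) ^ (N - Suc j) * (1 - q))"
    by (simp only: mult_ac)
  also have "\<dots> = real (N - j) * q * (real (N choose j) * q ^ j * (1 - q) ^ (N - j))"
    unfolding choose[symmetric] pow[symmetric] by (simp add: mult_ac)
  finally show ?thesis
    using assms by (simp add: of_nat_diff)
qed

text \<open>
  The weights at equal distance on both sides of \<open>k - 1/2\<close> are compared: the larger index has the
  larger weight.
\<close>

lemma binomial_upper_half:
  fixes q :: real
  assumes q: "0 < q" "q \<le> 1 / 2" and k: "real k \<le> real N * q"
  shows "1 / 2 \<le> (\<Sum>j=k..N. real (N choose j) * q ^ j * (1 - q) ^ (N - j))"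
proof -
  define b where "b j = real (N choose j) * q ^ j * (1 - q) ^ (N - j)" for j
  have b_nonneg: "b j \<ge> 0" for j
    using q by (simp add: b_def)
  have rec: "b (Suc j) * (real (Suc j) * (1 - q)) = (real N - real j) * q * b j" if "j < N" for j
    unfolding b_def by (rule binomial_weight_Suc[OF that])
  have "real N * q \<le> real N * (1 / 2)"
    using q by (intro mult_left_mono) auto
  then have kN: "2 * k \<le> N"
    using k by linarith
  \<comment> \<open>\<open>a\<close> is \<open>N - (k - 1)\<close>, the factor in \<open>rec\<close>
    for the step from \<open>k - 1\<close> to \<open>k\<close>. The next inequality says that the
    weights do not decrease across this step.\<close>
  define a where "a = real N - real k + 1"
  have a: "real k * (1 - q) \<le> a * q"
  proof -
    have "real k * (1 - q) \<le> real N * q * (1 - q)"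
      using k q by (intro mult_right_mono) auto
    also have "\<dots> = (real N - real N * q) * q"
      by (simp add: algebra_simps)
    also have "\<dots> \<le> a * q"
      using k q unfolding a_def by (intro mult_right_mono) auto
    finally show ?thesis .
  qed
  have refl_le: "b (k - 1 - i) \<le> b (k + i)" if "i < k" for i
    using that
  proof (induction i)
    case 0
    have "b k * (real k * (1 - q)) = a * q * b (k - 1)"
      using rec[of "k - 1"] 0 kN by (simp add: a_def of_nat_diff algebra_simps)
    also have "\<dots> \<ge> real k * (1 - q) * b (k - 1)"
      using a b_nonneg by (intro mult_right_mono) auto
    finally have "b (k - 1) * (real k * (1 - q)) \<le> b k * (real k * (1 - q))"
      by (simp add: mult.commute)
    moreover have "real k * (1 - q) > 0"
      using 0 q by auto
    ultimately show ?case
      by (simp add: mult_le_cancel_right)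
  next
    case (Suc i)
    define t where "t = real (Suc i)"
    define L where "L = b (k - 1 - Suc i)"
    define U where "U = b (k + Suc i)"
    have t: "0 < t" "t < real k"
      using Suc.prems by (auto simp: t_def)
    have IH: "b (k - 1 - i) \<le> b (k + i)"
      using Suc by simp
    have eq: "Suc (k - 1 - Suc i) = k - 1 - i"
      using Suc.prems by simp
    \<comment> \<open>One use of \<open>rec\<close> at each end: the lower index moves down from
      \<open>k - 1 - i\<close>, the upper one up from \<open>k + i\<close>.\<close>
    have L: "b (k - 1 - i) * ((real k - t) * (1 - q)) = (a + t) * q * L"
    proof -
      have "real (k - 1 - i) = real k - t" "real (k - 1 - Suc i) = real k - t - 1"
        using Suc.prems by (auto simp: t_def)
      then show ?thesis
        using rec[of "k - 1 - Suc i"] kN Suc.prems unfolding eq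
        by (simp add: L_def a_def algebra_simps)
    qed
    have U: "U * ((real k + t) * (1 - q)) = (a - t) * q * b (k + i)"
      using rec[of "k + i"] kN Suc.prems by (simp add: U_def a_def t_def algebra_simps)
    have at: "a - t > 0"
      using kN t by (simp add: a_def)
    \<comment> \<open>Combining both recurrences through the induction hypothesis pairs
      \<open>a + t\<close> with \<open>a - t\<close> and \<open>k - t\<close> with
      \<open>k + t\<close>, giving differences of squares.\<close>
    have "L * ((a\<^sup>2 - t\<^sup>2) * q\<^sup>2) = (a + t) * q * L * ((a - t) * q)"
      by (simp add: power2_eq_square algebra_simps)
    also have "\<dots> = b (k - 1 - i) * ((real k - t) * (1 - q) * ((a - t) * q))"
      by (simp flip: L)
    also have "\<dots> \<le> b (k + i) * ((real k - t) * (1 - q) * ((a - t) * q))"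
      using IH t at q by (intro mult_right_mono) auto
    also have "\<dots> = (a - t) * q * b (k + i) * ((real k - t) * (1 - q))"
      by (simp add: algebra_simps)
    also have "\<dots> = U * (((real k)\<^sup>2 - t\<^sup>2) * (1 - q)\<^sup>2)"
      unfolding U[symmetric] by (simp add: power2_eq_square algebra_simps)
    finally have LU: "L * ((a\<^sup>2 - t\<^sup>2) * q\<^sup>2) \<le> U * (((real k)\<^sup>2 - t\<^sup>2) * (1 - q)\<^sup>2)" .
    \<comment> \<open>Here \<open>q \<le> 1 / 2\<close> is decisive: the square subtracted on the
      side of \<open>1 - q\<close> is at least the one on the side of \<open>q\<close>, so the
      inequality \<open>a\<close> survives the subtraction.\<close>
    have "(real k * (1 - q))\<^sup>2 \<le> (a * q)\<^sup>2"
      using a q by (intro power_mono) auto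
    moreover have "(t * q)\<^sup>2 \<le> (t * (1 - q))\<^sup>2"
      using t q by (intro power_mono mult_left_mono) auto
    ultimately have "((real k)\<^sup>2 - t\<^sup>2) * (1 - q)\<^sup>2 \<le> (a\<^sup>2 - t\<^sup>2) * q\<^sup>2"
      by (simp add: power_mult_distrib left_diff_distrib)
    then have "L * (((real k)\<^sup>2 - t\<^sup>2) * (1 - q)\<^sup>2) \<le> L * ((a\<^sup>2 - t\<^sup>2) * q\<^sup>2)"
      using b_nonneg by (intro mult_left_mono) (auto simp: L_def)
    with LU have "L * (((real k)\<^sup>2 - t\<^sup>2) * (1 - q)\<^sup>2) \<le> U * (((real k)\<^sup>2 - t\<^sup>2) * (1 - q)\<^sup>2)"
      by linarith
    moreover have "((real k)\<^sup>2 - t\<^sup>2) * (1 - q)\<^sup>2 > 0"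
    proof -
      have "t\<^sup>2 < (real k)\<^sup>2"
        using t by (intro power_strict_mono) auto
      then show ?thesis
        using q by simp
    qed
    ultimately show ?case
      unfolding L_def U_def by (simp add: mult_le_cancel_right)
  qed
  have "(\<Sum>j<k. b j) = (\<Sum>i<k. b (k - Suc i))"
    by (rule sum.nat_diff_reindex[symmetric])
  also have "\<dots> \<le> (\<Sum>i<k. b (k + i))"
    using refl_le by (intro sum_mono) auto
  also have "\<dots> = sum b ((+) k ` {..<k})"
    by (subst sum.reindex) (auto simp: o_def)
  \<comment> \<open>The mirror indices are at most \<open>2 * k - 1\<close>, hence below
    \<open>N\<close> by \<open>kN\<close>.\<close>
  also have "\<dots> \<le> sum b {k..N}"
    using kN b_nonneg by (intro sum_mono2) auto
  finally have lower: "sum b {..<k} \<le> sum b {k..N}" .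
  have "1 = (q + (1 - q)) ^ N"
    by simp
  also have "\<dots> = sum b {..N}"
    unfolding binomial_ring b_def by simp
  also have "{..N} = {..<k} \<union> {k..N}"
    using kN by auto
  also have "sum b \<dots> = sum b {..<k} + sum b {k..N}"
    by (rule sum.union_disjoint) auto
  finally show ?thesis
    using lower unfolding b_def by linarith
qed

section \<open>Comparison of generic sets of different densities\<close>

text \<open>Both sides are compared with \<open>u k\<close>, the density of \<open>B\<close> in
  layer \<open>k\<close>, which depends on neither \<open>p\<close> nor \<open>q\<close>. The factor
  2 comes from \<open>binomial_upper_half\<close>.\<close>

lemma prob_increasing_small_le:
  assumes up: "\<forall>A\<in>B. \<forall>A'. A \<subseteq> A' \<longrightarrow> A' \<in> B"
    and q: "0 < q" "q \<le> 1 / 2" and k: "real k \<le> real N * q" and p: "0 \<le> p" "p \<le> 1"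
  shows "measure_pmf.prob (generic_set N p) {M \<in> B. card M \<le> k}
    \<le> 2 * measure_pmf.prob (generic_set N q) B"
proof -
  define u where "u j = real (card (slice N B j)) / real (N choose j)" for j
  define b where "b s j = real (N choose j) * s ^ j * (1 - s) ^ (N - j)" for s :: real and j
  \<comment> \<open>For \<open>j \<le> N\<close> the coefficient \<open>N choose j\<close> is
    nonzero, so the division in \<open>u\<close> cancels.\<close>
  have u_b: "real (card (slice N B j)) * (s ^ j * (1 - s) ^ (N - j)) = u j * b s j"
    if "j \<le> N" for s j
    using that by (simp add: u_def b_def)
  have b_nonneg: "b s j \<ge> 0" if "0 \<le> s" "s \<le> 1" for s j
    using that by (simp add: b_def)
  have u_nonneg: "u j \<ge> 0" for j
    by (simp add: u_def)
  have "real N * q \<le> real N * 1"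
    using q by (intro mult_left_mono) auto
  then have kN: "k \<le> N"
    using k by linarith
  have mono: "u i \<le> u j" if "i \<le> j" "j \<le> N" for i j
    unfolding u_def by (rule slice_density_mono[OF up that])
  have "measure_pmf.prob (generic_set N p) {M \<in> B. card M \<le> k} =
      (\<Sum>j\<le>N. real (card (slice N {M \<in> B. card M \<le> k} j)) * (p ^ j * (1 - p) ^ (N - j)))"
    by (rule prob_generic_set[OF p])
  \<comment> \<open>Layers above \<open>k\<close> contribute nothing, and those up to
    \<open>k\<close> have density at most \<open>u k\<close>; the weights \<open>b p j\<close> then
    sum to 1.\<close>
  also have "\<dots> \<le> (\<Sum>j\<le>N. u k * b p j)"
  proof (rule sum_mono)
    fix j assume j: "j \<in> {..N}"
    show "real (card (slice N {M \<in> B. card M \<le> k} j)) * (p ^ j * (1 - p) ^ (N - j)) \<le> u k * b p j"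
    proof (cases "j \<le> k")
      case True
      then have "slice N {M \<in> B. card M \<le> k} j = slice N B j"
        by (auto simp: slice_def)
      then show ?thesis
        using True j kN u_b[of j p] mono[of j k] b_nonneg[OF p] by (simp add: mult_right_mono)
    next
      case False
      then have "slice N {M \<in> B. card M \<le> k} j = {}"
        by (auto simp: slice_def)
      then show ?thesis
        using u_nonneg b_nonneg[OF p] by simp
    qed
  qed
  also have "\<dots> = u k * (p + (1 - p)) ^ N"
    unfolding binomial_ring b_def by (simp add: sum_distrib_left)
  finally have le_u: "measure_pmf.prob (generic_set N p) {M \<in> B. card M \<le> k} \<le> u k"
    by simp
  have "u k * (1 / 2) \<le> u k * (\<Sum>j=k..N. b q j)"
    unfolding b_def by (intro mult_left_mono binomial_upper_half q k u_nonneg)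
  also have "\<dots> \<le> (\<Sum>j=k..N. u j * b q j)"
    unfolding sum_distrib_left using q mono by (intro sum_mono mult_right_mono b_nonneg) auto
  also have "\<dots> \<le> (\<Sum>j\<le>N. u j * b q j)"
    using q by (intro sum_mono2) (auto intro!: mult_nonneg_nonneg u_nonneg b_nonneg)
  also have "\<dots> = measure_pmf.prob (generic_set N q) B"
    using q by (subst prob_generic_set) (auto simp: u_b)
  finally show ?thesis
    using le_u by linarith
qed

section \<open>The Fourier transform\<close>

text \<open>A geometric sum whose ratio \<open>e y / e x\<close> is an \<open>N\<close>-th root of
  unity, equal to 1 exactly when \<open>x = y\<close>.\<close>

lemma sum_unity_orthogonal:
  assumes x: "x < N" and y: "y < N"
  shows "(\<Sum>m<N. exp (- 2 * complex_of_real pi * \<i> * of_nat x * of_nat m / of_nat N) *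
      cnj (exp (- 2 * complex_of_real pi * \<i> * of_nat y * of_nat m / of_nat N))) =
    (if x = y then of_nat N else 0)"
proof -
  define e where "e j = exp (2 * complex_of_real pi * \<i> * of_nat j / of_nat N)" for j :: nat
  have e_nz: "e j \<noteq> 0" for j
    by (simp add: e_def)
  have e_pow: "e j ^ N = 1" for j
    unfolding e_def using complex_root_unity[of N j] x by auto
  have term_eq: "exp (- 2 * complex_of_real pi * \<i> * of_nat x * of_nat m / of_nat N) *
      cnj (exp (- 2 * complex_of_real pi * \<i> * of_nat y * of_nat m / of_nat N)) =
      (e y / e x) ^ m" for m
    unfolding e_def exp_cnj by (simp flip: exp_diff exp_of_nat_mult exp_add) (simp add: field_simps)
  have e_eq: "e y / e x = 1 \<longleftrightarrow> x = y"
    using complex_root_unity_eq[of N y x] x y e_nz by (auto simp: e_def)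
  show ?thesis
  proof (cases "x = y")
    case True
    then show ?thesis
      using e_eq unfolding term_eq by simp
  next
    case False
    then show ?thesis
      using e_eq e_pow unfolding term_eq by (subst geometric_sum) (auto simp: power_divide)
  qed
qed

text \<open>Expanding the squares as \<open>z * cnj z\<close> and summing over \<open>m\<close>
  first leaves only the diagonal terms.\<close>

lemma dft_Plancherel:
  "(\<Sum>m<N. (cmod (dft N f m))\<^sup>2) = (\<Sum>x<N. (cmod (f x))\<^sup>2)"
proof (cases "N = 0")
  case False
  define w where "w x m = exp (- 2 * complex_of_real pi * \<i> * of_nat x * of_nat m / of_nat N)"
    for x m :: nat
  have sq: "complex_of_real (1 / sqrt (real N)) * complex_of_real (1 / sqrt (real N)) = 1 / of_nat N"
    by (simp flip: of_real_mult)
  have "complex_of_real (\<Sum>m<N. (cmod (dft N f m))\<^sup>2) = (\<Sum>m<N. dft N f m * cnj (dft N f m))"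
    by (simp only: of_real_sum complex_norm_square)
  also have "\<dots> = (\<Sum>m<N. 1 / of_nat N * ((\<Sum>x<N. w x m * f x) * (\<Sum>y<N. cnj (w y m * f y))))"
    unfolding dft_def w_def[symmetric] complex_cnj_mult cnj_sum complex_cnj_complex_of_real sq[symmetric]
    by (simp only: mult_ac)
  also have "\<dots> = 1 / of_nat N *
      (\<Sum>m<N. \<Sum>x<N. \<Sum>y<N. f x * cnj (f y) * (w x m * cnj (w y m)))"
  proof -
    have "(\<Sum>x<N. w x m * f x) * (\<Sum>y<N. cnj (w y m * f y)) =
        (\<Sum>x<N. \<Sum>y<N. f x * cnj (f y) * (w x m * cnj (w y m)))" for m
      unfolding sum_product complex_cnj_mult by (intro sum.cong refl) (simp only: mult_ac)
    then show ?thesis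
      by (simp only: sum_distrib_left)
  qed
  also have "(\<Sum>m<N. \<Sum>x<N. \<Sum>y<N. f x * cnj (f y) * (w x m * cnj (w y m))) =
      (\<Sum>x<N. \<Sum>m<N. \<Sum>y<N. f x * cnj (f y) * (w x m * cnj (w y m)))"
    by (rule sum.swap)
  also have "\<dots> = (\<Sum>x<N. \<Sum>y<N. \<Sum>m<N. f x * cnj (f y) * (w x m * cnj (w y m)))"
    by (rule sum.cong[OF refl], rule sum.swap)
  also have "\<dots> = (\<Sum>x<N. \<Sum>y<N. f x * cnj (f y) * (if x = y then of_nat N else 0))"
  proof (intro sum.cong refl)
    fix x y assume "x \<in> {..<N}" "y \<in> {..<N}"
    then show "(\<Sum>m<N. f x * cnj (f y) * (w x m * cnj (w y m))) =
        f x * cnj (f y) * (if x = y then of_nat N else 0)"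
      using sum_unity_orthogonal[of x N y] unfolding w_def sum_distrib_left[symmetric] by simp
  qed
  also have "\<dots> = of_nat N * (\<Sum>x<N. f x * cnj (f x))"
    by (simp add: if_distrib sum_distrib_left mult_ac cong: if_cong)
  also have "(\<Sum>x<N. f x * cnj (f x)) = complex_of_real (\<Sum>x<N. (cmod (f x))\<^sup>2)"
    by (simp only: of_real_sum complex_norm_square)
  finally have "complex_of_real (\<Sum>m<N. (cmod (dft N f m))\<^sup>2) = complex_of_real (\<Sum>x<N. (cmod (f x))\<^sup>2)"
    using False by simp
  then show ?thesis
    by (simp only: of_real_eq_iff)
qed simp

section \<open>Norms and the deterministic bound for the Fourier ratio\<close>

lemma dft_add: "dft N (\<lambda>x. f x + g x) m = dft N f m + dft N g m"
  by (simp add: dft_def sum.distrib distrib_left)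

lemma Lp_norm_1: "Lp_norm 1 A g = (\<Sum>x\<in>A. cmod (g x))"
  by (simp add: Lp_norm_def sum_nonneg)

lemma Lp_norm_2: "Lp_norm 2 A g = L2_set (\<lambda>x. cmod (g x)) A"
proof -
  have "cmod z powr 2 = (cmod z)\<^sup>2" for z
    by simp
  then show ?thesis
    by (simp add: Lp_norm_def L2_set_def powr_half_sqrt sum_nonneg)
qed

lemma Lp_norm_2_dft: "Lp_norm 2 {..<N} (dft N f) = Lp_norm 2 {..<N} f"
  by (simp add: Lp_norm_2 L2_set_def dft_Plancherel)

text \<open>Cauchy-Schwarz against the constant function 1.\<close>

lemma Lp_norm_1_le_2: "Lp_norm 1 {..<N} g \<le> sqrt (real N) * Lp_norm 2 {..<N} g"
  using L2_set_mult_ineq[of "\<lambda>_. 1" "\<lambda>x. cmod (g x)" "{..<N}"]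
  by (simp add: Lp_norm_1 Lp_norm_2 L2_set_def)

text \<open>The inequality of \<^const>\<open>Talagrand_constants\<close>, with \<open>K\<close> for \<open>C\<^sub>T \<surd>(log N log log N)\<close>.\<close>

definition reverse_Cauchy_Schwarz_on :: "nat \<Rightarrow> real \<Rightarrow> nat set \<Rightarrow> bool" where
  "reverse_Cauchy_Schwarz_on N K M \<longleftrightarrow>
    (\<forall>h :: nat \<Rightarrow> complex. (\<forall>x<N. x \<notin> M \<longrightarrow> h x = 0) \<longrightarrow>
       sqrt (1 / real N * (\<Sum>m<N. (cmod (dft N h m))\<^sup>2))
         \<le> K * (1 / real N * (\<Sum>m<N. cmod (dft N h m))))"

lemma reverse_Cauchy_Schwarz_on_subset:
  "reverse_Cauchy_Schwarz_on N K M' \<Longrightarrow> M \<subseteq> M' \<Longrightarrow> reverse_Cauchy_Schwarz_on N K M"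
  unfolding reverse_Cauchy_Schwarz_on_def by blast

text \<open>With \<open>F\<close> the 2-norm of \<open>f\<close>, the part on \<open>M\<close> gives
  the transform 1-norm at least \<open>s * ((1 - r) * F) / K\<close>, and the rest removes at most
  \<open>s * (r * F)\<close>. By Plancherel the denominator of the ratio is
  \<open>F\<close>.\<close>

lemma Fourier_ratio_ge:
  assumes M: "reverse_Cauchy_Schwarz_on N K M" and K: "K > 0"
    and f: "\<exists>x<N. f x \<noteq> 0" and r: "r < 1"
    and conc: "Lp_norm 2 ({..<N} - M) f \<le> r * Lp_norm 2 {..<N} f"
  shows "sqrt (real N) * ((1 - r * (K / (1 - r))) / (K / (1 - r))) \<le> Fourier_ratio N f"
proof -
  define h where "h x = (if x \<in> M then f x else 0)" for x
  define g where "g x = (if x \<in> M then 0 else f x)" for x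
  define F where "F = Lp_norm 2 {..<N} f"
  define s where "s = sqrt (real N)"
  have N: "N > 0" and s: "s > 0" and ss: "s * s = real N"
    using f by (auto simp: s_def)
  obtain x0 where x0: "x0 < N" "f x0 \<noteq> 0"
    using f by blast
  then have "(\<Sum>x<N. (cmod (f x))\<^sup>2) > 0"
    by (intro sum_pos2[of _ x0]) auto
  then have F: "F > 0"
    by (simp add: F_def Lp_norm_2 L2_set_def)
  have f_eq: "f = (\<lambda>x. h x + g x)"
    by (auto simp: h_def g_def)
  have "(\<Sum>x<N. (cmod (g x))\<^sup>2) = (\<Sum>x\<in>{..<N} - M. (cmod (f x))\<^sup>2)"
    by (rule sum.mono_neutral_cong_right) (auto simp: g_def)
  then have g2: "Lp_norm 2 {..<N} g \<le> r * F"
    using conc by (simp add: Lp_norm_2 L2_set_def F_def)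
  have "F \<le> L2_set (\<lambda>x. cmod (h x) + cmod (g x)) {..<N}"
    unfolding F_def Lp_norm_2 by (rule L2_set_mono) (auto simp: h_def g_def)
  also have "\<dots> \<le> Lp_norm 2 {..<N} h + Lp_norm 2 {..<N} g"
    unfolding Lp_norm_2 by (rule L2_set_triangle_ineq)
  finally have h2: "(1 - r) * F \<le> Lp_norm 2 {..<N} h"
    using g2 by (simp add: algebra_simps)
  have g1: "Lp_norm 1 {..<N} (dft N g) \<le> s * (r * F)"
  proof -
    have "Lp_norm 1 {..<N} (dft N g) \<le> s * Lp_norm 2 {..<N} g"
      using Lp_norm_1_le_2[of N "dft N g"] by (simp add: s_def Lp_norm_2_dft)
    also have "\<dots> \<le> s * (r * F)"
      using g2 s by (intro mult_left_mono) auto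
    finally show ?thesis .
  qed
  have "sqrt (1 / real N * (\<Sum>m<N. (cmod (dft N h m))\<^sup>2))
      \<le> K * (1 / real N * (\<Sum>m<N. cmod (dft N h m)))"
    using M unfolding reverse_Cauchy_Schwarz_on_def by (simp add: h_def)
  then have "Lp_norm 2 {..<N} h / s \<le> K * Lp_norm 1 {..<N} (dft N h) / (s * s)"
    unfolding dft_Plancherel ss
    by (simp add: Lp_norm_1 Lp_norm_2 L2_set_def s_def real_sqrt_divide)
  then have "s * Lp_norm 2 {..<N} h \<le> K * Lp_norm 1 {..<N} (dft N h)"
    using s by (simp add: field_simps)
  moreover have "s * ((1 - r) * F) \<le> s * Lp_norm 2 {..<N} h"
    using h2 s by (intro mult_left_mono) auto
  ultimately have h1: "s * ((1 - r) * F) / K \<le> Lp_norm 1 {..<N} (dft N h)"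
    using K by (simp add: field_simps)
  \<comment> \<open>Triangle inequality for \<open>h = f - g\<close>, applied to the transforms
    pointwise.\<close>
  have "Lp_norm 1 {..<N} (dft N h) \<le> Lp_norm 1 {..<N} (dft N f) + Lp_norm 1 {..<N} (dft N g)"
  proof -
    have "cmod (dft N h m) \<le> cmod (dft N f m) + cmod (dft N g m)" for m
      unfolding f_eq dft_add using norm_triangle_ineq4[of "dft N h m + dft N g m" "dft N g m"] by simp
    then show ?thesis
      unfolding Lp_norm_1 sum.distrib[symmetric] by (rule sum_mono)
  qed
  with g1 h1 have "s * ((1 - r) * F) / K - s * (r * F) \<le> Lp_norm 1 {..<N} (dft N f)"
    by linarith
  then have "(s * ((1 - r) * F) / K - s * (r * F)) / F \<le> Fourier_ratio N f"
    unfolding Fourier_ratio_def Lp_norm_2_dft F_def[symmetric] using F by (intro divide_right_mono) auto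
  moreover have "(s * ((1 - r) * F) / K - s * (r * F)) / F =
      s * ((1 - r * (K / (1 - r))) / (K / (1 - r)))"
    using F K r by (simp add: field_simps)
  ultimately show ?thesis
    by (simp add: s_def)
qed

section \<open>Passage to the limit\<close>

text \<open>The size bound is a premise inside the event, so too large sets count as successes. As
  \<open>f\<close> and \<open>r\<close> are quantified inside it too, one event serves all
  functions, including those chosen after \<open>M\<close>.\<close>

theorem theorem1p10:
  fixes \<gamma>0 C_T :: real and p :: "nat \<Rightarrow> real"
  assumes "0 < \<gamma>0" and "\<gamma>0 < 1" and "0 < C_T"
    and "Talagrand_constants \<gamma>0 C_T"
    and "\<And>N. 0 < p N \<and> p N < 1"
  shows "(\<lambda>N. measure_pmf.prob (generic_set N (p N))
           {M. real (card M) \<le> \<gamma>0 * (real N / ln (real N)) \<longrightarrow>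
               (\<forall>(f :: nat \<Rightarrow> complex) (r :: real).
                  (\<exists>x<N. f x \<noteq> 0) \<longrightarrow>
                  0 < r \<longrightarrow> r < 1 \<longrightarrow>
                  Lp_norm 2 ({..<N} - M) f \<le> r * Lp_norm 2 {..<N} f \<longrightarrow>
                  r < (1 - r) / (C_T * sqrt (ln (real N) * ln (ln (real N)))) \<longrightarrow>
                  Fourier_ratio N f \<ge>
                    sqrt (real N) *
                    ((1 - r * ((C_T * sqrt (ln (real N) * ln (ln (real N)))) / (1 - r))) /
                     ((C_T * sqrt (ln (real N) * ln (ln (real N)))) / (1 - r))))})
         \<longlonglongrightarrow> 1"
    (is "(\<lambda>N. measure_pmf.prob (generic_set N (p N)) (?E N)) \<longlonglongrightarrow> 1")
proof -
  define K where "K N = C_T * sqrt (ln (real N) * ln (ln (real N)))" for N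
  define q where "q N = \<gamma>0 / ln (real N)" for N
  define B where "B N = {M. \<not> reverse_Cauchy_Schwarz_on N (K N) M}" for N
  have "(\<lambda>N. measure_pmf.prob (generic_set N (q N)) (- B N)) \<longlonglongrightarrow> 1"
    using assms(4)
    unfolding Talagrand_constants_def q_def B_def K_def reverse_Cauchy_Schwarz_on_def Collect_neg_eq
      double_complement .
  \<comment> \<open>This is the lower bound needed for the final sandwich.\<close>
  then have "(\<lambda>N. 1 - 2 * (1 - measure_pmf.prob (generic_set N (q N)) (- B N))) \<longlonglongrightarrow> 1"
    by (auto intro!: tendsto_eq_intros)
  moreover have "1 - measure_pmf.prob (generic_set N (q N)) (- B N) =
      measure_pmf.prob (generic_set N (q N)) (B N)" for N
    using measure_pmf.prob_compl[of "B N" "generic_set N (q N)"] by (simp add: Compl_eq_Diff_UNIV)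
  ultimately have lim: "(\<lambda>N. 1 - 2 * measure_pmf.prob (generic_set N (q N)) (B N)) \<longlonglongrightarrow> 1"
    by simp
  have ln_top: "filterlim (\<lambda>N. ln (real N)) at_top sequentially"
    by (rule filterlim_compose[OF ln_at_top filterlim_real_sequentially])
  \<comment> \<open>The threshold 2 ensures \<open>q N \<le> 1 / 2\<close>, as
    \<open>\<gamma>0 < 1\<close>, and makes \<open>ln (ln (real N))\<close>, hence
    \<open>K N\<close>, positive.\<close>
  have "eventually (\<lambda>N. ln (real N) \<ge> 2) sequentially"
    using ln_top by (simp add: filterlim_at_top)
  then have le: "eventually (\<lambda>N. 1 - 2 * measure_pmf.prob (generic_set N (q N)) (B N)
      \<le> measure_pmf.prob (generic_set N (p N)) (?E N)) sequentially"
  proof eventually_elim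
    case (elim N)
    define k where "k = nat \<lfloor>real N * q N\<rfloor>"
    have q: "0 < q N" "q N \<le> 1 / 2"
      using elim assms(1,2) by (auto simp: q_def field_simps)
    have k: "real k \<le> real N * q N"
      using q by (simp add: k_def)
    have K: "K N > 0"
      using elim assms(3) by (simp add: K_def)
    have "measure_pmf.prob (generic_set N (p N)) {M \<in> B N. card M \<le> k}
        \<le> 2 * measure_pmf.prob (generic_set N (q N)) (B N)"
      using assms(5)[of N] q k
      by (intro prob_increasing_small_le)
         (auto simp: B_def dest: reverse_Cauchy_Schwarz_on_subset)
    moreover have "measure_pmf.prob (generic_set N (p N)) (- {M \<in> B N. card M \<le> k}) =
        1 - measure_pmf.prob (generic_set N (p N)) {M \<in> B N. card M \<le> k}"
      using measure_pmf.prob_compl[of "{M \<in> B N. card M \<le> k}"]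
      by (simp add: Compl_eq_Diff_UNIV)
    \<comment> \<open>A set outside the small bad ones is either good, so that
      \<open>Fourier_ratio_ge\<close> applies, or has more than \<open>k\<close> elements. In the
      latter case its integer size exceeds \<open>N * q N\<close>, and the implication is
      vacuous.\<close>
    moreover have "measure_pmf.prob (generic_set N (p N)) (- {M \<in> B N. card M \<le> k})
        \<le> measure_pmf.prob (generic_set N (p N)) (?E N)"
    proof (rule measure_pmf.finite_measure_mono)
      have good: "M \<in> ?E N" if "M \<notin> B N" for M
        using that Fourier_ratio_ge[OF _ K] unfolding B_def K_def by blast
      have large: "M \<in> ?E N" if "\<not> card M \<le> k" for M
      proof -
        have "\<not> real (card M) \<le> real N * q N"
          using that le_nat_floor[of "card M" "real N * q N"] unfolding k_def by blast
        then show ?thesis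
          by (simp add: q_def mult.commute)
      qed
      show "- {M \<in> B N. card M \<le> k} \<subseteq> ?E N"
      proof
        fix M assume M: "M \<in> - {M \<in> B N. card M \<le> k}"
        show "M \<in> ?E N"
        proof (cases "M \<in> B N")
          case True
          then show ?thesis
            using M by (intro large) simp
        qed (rule good)
      qed
    qed simp
    ultimately show ?case
      by linarith
  qed
  show ?thesis
    by (rule tendsto_sandwich[OF le _ lim tendsto_const[of 1]]) simp
qed

end
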